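(* Let $K$ be a field of characteristic different from $2$ and $3$. Denote by $\mathrm{Lie}$, $\mathrm{Malcev}$, $\mathrm{Sagle}$, $\mathrm{BinaryLie}$, $\mathrm{AlmostLie}$ and $\mathrm{CD}$ the varieties (classes) of, respectively, Lie, Malcev, Sagle, binary Lie, almost Lie and CD algebras over $K$ (all anticommutative). Then the following inclusions hold, and all of them are strict: $$\mathrm{Lie} \subsetneq \mathrm{Malcev} \cap \mathrm{Sagle} \subsetneq \mathrm{CD}, \qquad \mathrm{CD} \subsetneq \mathrm{BinaryLie}, \qquad \mathrm{CD} \subsetneq \mathrm{AlmostLie}.$$
   Context: All algebras are nonassociative (not necessarily associative) algebras over a field $K$ of characteristic $\neq 2,3$, of arbitrary dimension, and are anticommutative: $xy=-yx$. The Jacobiator is $J(x,y,z)=(xy)z+(zx)y+(yz)x$. An (anticommutative) algebra $A$ is called: - Lie if $J(x,y,z)=0$ for all $x,y,z\in A$; - Malcev if $J(x,y,xz)=J(x,y,z)x$ for all $x,y,z\in A$; - Sagle if $J(x,y,z)w = J(w,z,xy)+J(w,y,zx)+J(w,x,yz)$ for all $x,y,z,w\in A$; - binary Lie if $J(xy,x,y)=0$ for all $x,y\in A$; - almost Lie if $J(x,y,z)w=0$ for all $x,y,z,w\in A$; - CD if for all $a,b\in A$ the commutator $[R_a,R_b]$ of right multiplications is a derivation of $A$, where $R_a(x)=xa$; equivalently, for all $x,y,a,b\in A$, $$((xy)a)b - ((xy)b)a - ((xa)b)y + ((xb)a)y + ((ya)b)x - ((yb)a)x = 0.$$ *)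

theory Defs
  imports
    Complex_Main
    "HOL-Library.Poly_Mapping"
begin

locale anticommutative_algebra = vector_space scale
  for scale :: "'k::field \<Rightarrow> 'a::ab_group_add \<Rightarrow> 'a" +
  fixes mul :: "'a \<Rightarrow> 'a \<Rightarrow> 'a"
  assumes linear_mult_left: "Vector_Spaces.linear scale scale (\<lambda>x. mul x y)"
    and linear_mult_right: "Vector_Spaces.linear scale scale (\<lambda>y. mul x y)"
    and anticommute: "mul x y = - mul y x"

definition jacobiator :: "('a::ab_group_add \<Rightarrow> 'a \<Rightarrow> 'a) \<Rightarrow> 'a \<Rightarrow> 'a \<Rightarrow> 'a \<Rightarrow> 'a" where
  "jacobiator mul x y z =
     mul (mul x y) z + mul (mul z x) y + mul (mul y z) x"

definition right_mult :: "('a \<Rightarrow> 'a \<Rightarrow> 'a) \<Rightarrow> 'a \<Rightarrow> 'a \<Rightarrow> 'a" where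
  "right_mult mul a = (\<lambda>x. mul x a)"

definition commutator :: "('a::ab_group_add \<Rightarrow> 'a) \<Rightarrow> ('a \<Rightarrow> 'a) \<Rightarrow> 'a \<Rightarrow> 'a" where
  "commutator S T = (\<lambda>x. S (T x) - T (S x))"

definition derivation ::
    "('k::field \<Rightarrow> 'a::ab_group_add \<Rightarrow> 'a) \<Rightarrow> ('a \<Rightarrow> 'a \<Rightarrow> 'a) \<Rightarrow> ('a \<Rightarrow> 'a) \<Rightarrow> bool" where
  "derivation scale mul D \<longleftrightarrow>
     Vector_Spaces.linear scale scale D \<and>
     (\<forall>x y. D (mul x y) = mul (D x) y + mul x (D y))"

text \<open>
  An algebra over \<^typ>\<open>'k\<close> with underlying abelian group \<^typ>\<open>'a\<close> is the pair of its
  scalar multiplication and its product. The classes below therefore collect all algebras of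
  the given kind carried by the group \<^typ>\<open>'a\<close>; a class of algebras in the usual sense is the
  family of these sets over all \<^typ>\<open>'a\<close>. An inclusion of classes is thus an inclusion of
  these sets for every \<^typ>\<open>'a\<close>, and a strict one is moreover proper for some \<^typ>\<open>'a\<close>
  (for a small \<^typ>\<open>'a\<close>, such as a trivial group, the sets coincide). For \<^typ>\<open>'a\<close> one can
  take \<^typ>\<open>nat \<Rightarrow>\<^sub>0 'k\<close>: two varieties differ iff their free algebras of countable rank do,
  and these have at most countable dimension over \<^typ>\<open>'k\<close>. The scalar multiplication on
  \<^typ>\<open>nat \<Rightarrow>\<^sub>0 'k\<close> is part of the algebra and not fixed in advance.
\<close>

type_synonym ('k, 'a) algebra = "('k \<Rightarrow> 'a \<Rightarrow> 'a) \<times> ('a \<Rightarrow> 'a \<Rightarrow> 'a)"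

definition Lie :: "('k::field, 'a::ab_group_add) algebra set" where
  "Lie = {(scale, mul). anticommutative_algebra scale mul \<and>
     (\<forall>x y z. jacobiator mul x y z = 0)}"

definition Malcev :: "('k::field, 'a::ab_group_add) algebra set" where
  "Malcev = {(scale, mul). anticommutative_algebra scale mul \<and>
     (\<forall>x y z. jacobiator mul x y (mul x z) = mul (jacobiator mul x y z) x)}"

definition Sagle :: "('k::field, 'a::ab_group_add) algebra set" where
  "Sagle = {(scale, mul). anticommutative_algebra scale mul \<and>
     (\<forall>x y z w. mul (jacobiator mul x y z) w =
        jacobiator mul w z (mul x y) + jacobiator mul w y (mul z x)
        + jacobiator mul w x (mul y z))}"

definition BinaryLie :: "('k::field, 'a::ab_group_add) algebra set" where
  "BinaryLie = {(scale, mul). anticommutative_algebra scale mul \<and>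
     (\<forall>x y. jacobiator mul (mul x y) x y = 0)}"

definition AlmostLie :: "('k::field, 'a::ab_group_add) algebra set" where
  "AlmostLie = {(scale, mul). anticommutative_algebra scale mul \<and>
     (\<forall>x y z w. mul (jacobiator mul x y z) w = 0)}"

definition CD :: "('k::field, 'a::ab_group_add) algebra set" where
  "CD = {(scale, mul). anticommutative_algebra scale mul \<and>
     (\<forall>a b. derivation scale mul (commutator (right_mult mul a) (right_mult mul b)))}"

end

theory Submission
  imports Defs "HOL-Computational_Algebra.Primes"
begin

text \<open>
  Measured by Jacobiators, an algebra is CD iff \<open>J(x,y,z)w = 0\<close> and
  \<open>J(x,y,ab) = - J(a,b,xy)\<close>; hence CD algebras are almost Lie, and \<open>a = x\<close>, \<open>b = y\<close>
  shows that they are binary Lie. Let \<open>S\<close> be the right-hand side of the Sagle identity and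
  \<open>S'\<close> the same sum with the pairs \<open>ab|cd\<close> exchanged. The linearized Malcev identity
  expresses \<open>S - S'\<close>, and anticommutativity alone \<open>S + S'\<close>, by products \<open>J(a,b,c)d\<close>;
  adding gives \<open>2 S = - 4 J(x,y,z)w\<close>, so the Sagle identity forces \<open>6 J(x,y,z)w = 0\<close>.
  Then \<open>J(x,y,zw)\<close> is alternating in its four arguments, so the Sagle identity reads
  \<open>3 J(x,y,zw) = 0\<close>, and the CD criterion holds trivially. The inclusions are separated by
  algebras of dimension at most 6.
\<close>

section \<open>Division by 2 and 3\<close>

lemma two_neq_0_field:
  assumes "CHAR('k::field) \<noteq> 2"
  shows "(2::'k) \<noteq> 0"
proof -
  have "\<not> CHAR('k) dvd 2"
    using assms CHAR_not_1'[where 'a='k] two_is_prime_nat by (metis One_nat_def prime_nat_iff)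
  then show ?thesis
    by (metis of_nat_eq_0_iff_char_dvd of_nat_numeral)
qed

lemma three_neq_0_field:
  assumes "CHAR('k::field) \<noteq> 3"
  shows "(3::'k) \<noteq> 0"
proof -
  have "prime (3::nat)"
    by (simp add: prime_nat_numeral_eq)
  then have "\<not> CHAR('k) dvd 3"
    using assms CHAR_not_1'[where 'a='k] by (metis One_nat_def prime_nat_iff)
  then show ?thesis
    by (metis of_nat_eq_0_iff_char_dvd of_nat_numeral)
qed

section \<open>Jacobiator identities\<close>

context anticommutative_algebra
begin

sublocale left: additive "\<lambda>x. mul x y" for y
  using linear_mult_left[of y] by unfold_locales (simp add: Vector_Spaces.linear_iff)

sublocale right: additive "\<lambda>y. mul x y" for x
  using linear_mult_right[of x] by unfold_locales (simp add: Vector_Spaces.linear_iff)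

lemmas mul_simps = left.add left.diff left.minus left.zero right.add right.diff right.minus right.zero

abbreviation J where "J \<equiv> jacobiator mul"

lemma double_eq_0D:
  fixes v :: 'a
  assumes "CHAR('k) \<noteq> 2" "v + v = 0"
  shows "v = 0"
proof -
  have "scale 2 v = 0"
    using assms(2) by (metis one_add_one scale_left_distrib scale_one)
  with two_neq_0_field[OF assms(1)] show ?thesis by simp
qed

lemma triple_eq_0D:
  fixes v :: 'a
  assumes "CHAR('k) \<noteq> 3" "v + v + v = 0"
  shows "v = 0"
proof -
  have "scale 3 v = v + v + v"
    by (metis numeral_Bit1 numeral_One one_add_one scale_left_distrib scale_one)
  with three_neq_0_field[OF assms(1)] assms(2) show ?thesis by simp
qed

lemma J_swap12: "J y x z = - J x y z"
  unfolding jacobiator_def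
  by (simp add: anticommute[of y x] anticommute[of z y] anticommute[of x z] mul_simps algebra_simps)

lemma J_rotate: "J y z x = J x y z"
  by (simp add: jacobiator_def algebra_simps)

lemma J_swap23: "J x z y = - J x y z"
  by (metis J_rotate J_swap12)

lemma J_add:
  "J (x + x') y z = J x y z + J x' y z"
  "J x (y + y') z = J x y z + J x y' z"
  "J x y (z + z') = J x y z + J x y z'"
  by (simp_all add: jacobiator_def mul_simps algebra_simps)

lemma J_minus: "J x y (- z) = - J x y z"
  by (simp add: jacobiator_def mul_simps algebra_simps)

text \<open>Polarization: the Malcev identity is quadratic in \<open>x\<close>, and the mixed terms
  of its instance at \<open>x + w\<close> give this form.\<close>

lemma Malcev_linearized:
  assumes "(scale, mul) \<in> Malcev"
  shows "J x y (mul w z) + J w y (mul x z) = mul (J x y z) w + mul (J w y z) x"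
proof -
  have M: "J u y (mul u z) = mul (J u y z) u" for u
    using assms by (simp add: Malcev_def)
  from M[of "x + w"] M[of x] M[of w] show ?thesis
    by (simp add: J_add mul_simps algebra_simps)
qed

text \<open>This holds in every anticommutative algebra: the products \<open>(ab)(cd)\<close> cancel.\<close>

lemma jacobiator_product_sum:
  "J w z (mul x y) + J w y (mul z x) + J w x (mul y z)
     + (J y z (mul w x) + J z x (mul w y) + J x y (mul w z))
   = - mul (J x y z) w - (mul (J w z y) x + mul (J w x z) y + mul (J w y x) z)"
  unfolding jacobiator_def
  by (simp add: anticommute[of y x] anticommute[of z x] anticommute[of z y]
      anticommute[of x w] anticommute[of y w] anticommute[of z w]
      anticommute[of "mul y z" "mul w x"] anticommute[of "mul x z" "mul w y"]
      anticommute[of "mul x y" "mul w z"]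
      anticommute[of x "mul y z"] anticommute[of y "mul x z"] anticommute[of z "mul x y"]
      anticommute[of w "mul y z"] anticommute[of w "mul x z"] anticommute[of w "mul x y"]
      anticommute[of x "mul w z"] anticommute[of y "mul w z"] anticommute[of z "mul w y"]
      anticommute[of x "mul w y"] anticommute[of y "mul w x"] anticommute[of z "mul w x"]
      mul_simps algebra_simps)

section \<open>The CD identity in terms of Jacobiators\<close>

lemma CD_iff:
  assumes "CHAR('k) \<noteq> 2"
  shows "(scale, mul) \<in> CD \<longleftrightarrow>
    (\<forall>x y z w. mul (J x y z) w = 0) \<and> (\<forall>x y z w. J x y (mul z w) = - J z w (mul x y))"
proof -
  define D where "D = (\<lambda>a b. commutator (right_mult mul a) (right_mult mul b))"
  have D_eq: "D a b = commutator (right_mult mul a) (right_mult mul b)" for a b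
    by (simp add: D_def)
  have D: "D a b x = mul (mul x b) a - mul (mul x a) b" for a b x
    by (simp add: D_def commutator_def right_mult_def)
  have linear_D: "Vector_Spaces.linear scale scale (D a b)" for a b
    using linear_mult_left
    by (simp add: Vector_Spaces.linear_iff D mul_simps algebra_simps scale_right_diff_distrib)
  \<comment> \<open>By anticommutativity \<open>J x b a\<close> is
    \<open>D a b x + mul (mul b a) x\<close>, and likewise with \<open>y\<close> or
    \<open>mul x y\<close> for \<open>x\<close>. The terms containing \<open>mul b a\<close> cancel
    against \<open>J x y (mul b a)\<close>.\<close>
  have defect: "D a b (mul x y) - (mul (D a b x) y + mul x (D a b y))
      = J b a (mul x y) + J x y (mul b a) - mul (J x b a) y + mul (J y b a) x" for a b x y
    unfolding D jacobiator_def
    by (simp add: mul_simps anticommute[of a "mul x y"] anticommute[of a x] anticommute[of a y]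
        anticommute[of "mul b a" x] anticommute[of y "mul b a"]
        anticommute[of "mul b a" "mul x y"]
        anticommute[of x "mul (mul y b) a"] anticommute[of x "mul (mul y a) b"] algebra_simps)
  have CD: "(scale, mul) \<in> CD \<longleftrightarrow>
      (\<forall>a b x y. J b a (mul x y) + J x y (mul b a) - mul (J x b a) y + mul (J y b a) x = 0)"
    using anticommutative_algebra_axioms linear_D
    by (simp add: CD_def derivation_def flip: D_eq defect)
  show ?thesis
  proof
    assume "(scale, mul) \<in> CD"
    then have eq: "J b a (mul x y) + J x y (mul b a) - mul (J x b a) y + mul (J y b a) x = 0"
      for a b x y using CD by blast
    have zero: "mul (J x y z) w = 0" for x y z w
    proof (rule double_eq_0D[OF assms])
      define E where "E = (\<lambda>b a x y.
        J b a (mul x y) + J x y (mul b a) - mul (J x b a) y + mul (J y b a) x)"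
      have "E b a x y = 0" for a b x y
        using eq by (simp add: E_def)
      \<comment> \<open>Cyclic sum over \<open>x\<close>, \<open>y\<close>, \<open>z\<close> with
        \<open>w\<close> fixed. Once \<open>jacobiator_product_sum\<close> evaluates the Jacobiators
        of products, the terms \<open>mul (J w x y) z\<close> and their rotations cancel; only
        \<open>mul (J x y z) w\<close> remains, with factor -2.\<close>
      moreover have "mul (J x y z) w + mul (J x y z) w = - (E x y z w + E y z x w + E z x y w)"
        using jacobiator_product_sum[of w z x y, unfolded eq_diff_eq]
        unfolding E_def
        by (simp add: J_swap12[of x w] J_swap12[of y w] J_swap12[of z w]
            J_swap23[of w y x] J_swap23[of w x z] J_swap23[of w z y]
            J_swap12[of y x] J_swap12[of x z] J_swap12[of z y]
            J_rotate[of y z x] J_rotate[of z x y]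
            J_minus anticommute[of z w] anticommute[of x w] anticommute[of y w]
            mul_simps algebra_simps)
      ultimately show "mul (J x y z) w + mul (J x y z) w = 0"
        by simp
    qed
    show "(\<forall>x y z w. mul (J x y z) w = 0) \<and> (\<forall>x y z w. J x y (mul z w) = - J z w (mul x y))"
      using eq by (simp add: zero eq_neg_iff_add_eq_0)
  next
    assume "(\<forall>x y z w. mul (J x y z) w = 0) \<and> (\<forall>x y z w. J x y (mul z w) = - J z w (mul x y))"
    then show "(scale, mul) \<in> CD"
      unfolding CD by (metis add.right_neutral diff_zero add.left_inverse)
  qed
qed

section \<open>Algebras that are both Malcev and Sagle\<close>

lemma Malcev_Sagle_imp:
  assumes char: "CHAR('k) \<noteq> 2" "CHAR('k) \<noteq> 3"
    and Malcev: "(scale, mul) \<in> Malcev" and Sagle: "(scale, mul) \<in> Sagle"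
  shows "mul (J x y z) w = 0" and "J x y (mul z w) = 0"
proof -
  note lin = Malcev_linearized[OF Malcev]
  have sagle: "mul (J x y z) w = J w z (mul x y) + J w y (mul z x) + J w x (mul y z)" for x y z w
    using Sagle by (simp add: Sagle_def)
  have JA: "mul (J x y z) w = 0" for x y z w
  proof -
    define T where "T = mul (J x y z) w"
    define Q where "Q = mul (J w z y) x + mul (J w x z) y + mul (J w y x) z"
    define S where "S = J w z (mul x y) + J w y (mul z x) + J w x (mul y z)"
    define S' where "S' = J y z (mul w x) + J z x (mul w y) + J x y (mul w z)"
    have "S = T"
      by (simp add: S_def T_def sagle)
    have "S - S' = Q - T - T - T"
    proof -
      define E where "E = (\<lambda>a b c d.
        J a b (mul c d) + J c b (mul a d) - mul (J a b d) c - mul (J c b d) a)"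
      have "E a b c d = 0" for a b c d
        using lin[of a b c d] by (simp add: E_def)
      \<comment> \<open>Each instance of \<open>E\<close> trades one summand of \<open>S\<close> for
        one of \<open>S'\<close>, at the cost of one summand of \<open>Q\<close> and one
        \<open>- T\<close>.\<close>
      moreover have "S - S' = Q - T - T - T - (E w z y x + E w x z y + E w y x z)"
        unfolding S_def S'_def Q_def T_def E_def
        by (simp add: J_swap12[of y x] J_swap12[of x z] J_swap12[of z y]
            J_swap23[of w z x] J_swap23[of w x y] J_swap23[of w y z]
            J_rotate[of y z x] J_rotate[of z x y]
            anticommute[of y x] anticommute[of x z] anticommute[of z y]
            J_minus mul_simps algebra_simps)
      ultimately show ?thesis
        by simp
    qed
    moreover have "S + S' = - T - Q"
      unfolding S_def S'_def T_def Q_def by (rule jacobiator_product_sum)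
    ultimately have "S + S = - T - T - T - T"
      by (simp add: algebra_simps)
    then have "(T + T) + (T + T) + (T + T) = 0"
      using \<open>S = T\<close> by (simp add: algebra_simps)
    from double_eq_0D[OF char(1) triple_eq_0D[OF char(2) this]] show ?thesis
      by (simp add: T_def)
  qed
  then show "mul (J x y z) w = 0" .
  have lin0: "J a b (mul c d) = - J c b (mul a d)" for a b c d
    using lin[of a b c d] by (simp add: JA eq_neg_iff_add_eq_0)
  \<comment> \<open>With the first argument fixed, the other three may be rotated; this makes the
    three summands of the Sagle identity equal.\<close>
  have cycle: "J a b (mul c d) = J a c (mul d b)" for a b c d
    using lin0[of b a c d]
    unfolding J_swap12[of b a] J_swap12[of c a] anticommute[of d b] J_minus
    by (metis minus_minus)
  have "J x y (mul z w) + J x y (mul z w) + J x y (mul z w) = mul (J z w y) x"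
    using cycle[of x y z w] cycle[of x z w y] by (simp add: sagle algebra_simps)
  then have "J x y (mul z w) + J x y (mul z w) + J x y (mul z w) = 0"
    by (simp add: JA)
  then show "J x y (mul z w) = 0"
    by (rule triple_eq_0D[OF char(2)])
qed

end

section \<open>Algebras given by structure constants\<close>

abbreviation coord :: "(nat \<Rightarrow>\<^sub>0 'k::zero) \<Rightarrow> nat \<Rightarrow> 'k" where
  "coord \<equiv> Poly_Mapping.lookup"

definition coeff_scale :: "'k::field \<Rightarrow> (nat \<Rightarrow>\<^sub>0 'k) \<Rightarrow> nat \<Rightarrow>\<^sub>0 'k" where
  "coeff_scale c = Poly_Mapping.map ((*) c)"

text \<open>
  An entry \<open>(i, j, k, c)\<close> stands for \<open>e\<^sub>i e\<^sub>j = - e\<^sub>j e\<^sub>i = c e\<^sub>k\<close>;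
  products of basis vectors without an entry are zero.
\<close>

definition table_mul ::
    "(nat \<times> nat \<times> nat \<times> 'k) list \<Rightarrow> (nat \<Rightarrow>\<^sub>0 'k::field) \<Rightarrow> (nat \<Rightarrow>\<^sub>0 'k) \<Rightarrow> nat \<Rightarrow>\<^sub>0 'k" where
  "table_mul T f g = (\<Sum>(i, j, k, c)\<leftarrow>T.
     Poly_Mapping.single k (c * (coord f i * coord g j - coord f j * coord g i)))"

lemma lookup_coeff_scale [simp]: "coord (coeff_scale c f) n = c * coord f n"
  by (simp add: coeff_scale_def Poly_Mapping.map.rep_eq when_def)

lemma lookup_table_mul:
  "coord (table_mul T f g) n = (\<Sum>(i, j, k, c)\<leftarrow>T.
     c * (coord f i * coord g j - coord f j * coord g i) when k = n)"
  by (induction T) (auto simp: table_mul_def lookup_add lookup_single)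

lemma vector_space_coeff_scale: "vector_space coeff_scale"
  by unfold_locales (auto intro!: poly_mapping_eqI simp: lookup_add algebra_simps)

text \<open>Each entry contributes an alternating bilinear form times a basis vector. Basis vectors
  that are a factor in no entry annihilate everything, so a small example lives on the
  infinite-dimensional space without new nonzero products.\<close>

lemma anticommutative_table_mul: "anticommutative_algebra coeff_scale (table_mul T)"
proof -
  have "table_mul T (f + f') g = table_mul T f g + table_mul T f' g"
       "table_mul T g (f + f') = table_mul T g f + table_mul T g f'"
       "table_mul T (coeff_scale c f) g = coeff_scale c (table_mul T f g)"
       "table_mul T g (coeff_scale c f) = coeff_scale c (table_mul T g f)" for f f' g c
    by (rule poly_mapping_eqI,
        induction T, auto simp: lookup_table_mul lookup_add when_def algebra_simps)+
  then have linear: "Vector_Spaces.linear coeff_scale coeff_scale (\<lambda>f. table_mul T f g)"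
      "Vector_Spaces.linear coeff_scale coeff_scale (table_mul T g)" for g
    by (simp_all add: Vector_Spaces.linear_iff vector_space_coeff_scale)
  have "table_mul T f g = - table_mul T g f" for f g
    by (rule poly_mapping_eqI,
        induction T, auto simp: lookup_table_mul lookup_add when_def algebra_simps)
  with linear vector_space_coeff_scale show ?thesis
    unfolding anticommutative_algebra_def anticommutative_algebra_axioms_def by blast
qed

lemmas table_simps = lookup_table_mul jacobiator_def lookup_add lookup_minus lookup_single when_def

abbreviation e :: "nat \<Rightarrow> nat \<Rightarrow>\<^sub>0 'k::field" where
  "e i \<equiv> Poly_Mapping.single i 1"

section \<open>Separating examples\<close>

text \<open>All products of four factors vanish, hence both sides of the Malcev and Sagle
  identities; products of three factors survive in the Jacobiator of \<open>e 0\<close>,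
  \<open>e 1\<close>, \<open>e 2\<close>.\<close>

lemma ex_Malcev_Sagle_not_Lie:
  fixes T :: "(nat \<times> nat \<times> nat \<times> 'k::field) list"
  defines "T \<equiv> [(0, 1, 3, 1), (3, 2, 4, 1)]"
  shows "(coeff_scale, table_mul T) \<in> Malcev \<inter> Sagle - Lie"
proof -
  interpret anticommutative_algebra coeff_scale "table_mul T"
    by (rule anticommutative_table_mul)
  have "table_mul T (table_mul T (table_mul T x y) z) w = 0"
       "table_mul T (table_mul T x y) (table_mul T z w) = 0" for x y z w
    by (rule poly_mapping_eqI, simp add: T_def table_simps)+
  then have "J x y (table_mul T z w) = 0" "table_mul T (J x y z) w = 0" for x y z w
    by (simp_all add: jacobiator_def mul_simps anticommute[of _ "table_mul T z w"])
  moreover have "coord (J (e 0) (e 1) (e 2)) 4 = 1"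
    by (simp add: T_def table_simps)
  then have "J (e 0) (e 1) (e 2) \<noteq> 0" by auto
  ultimately show ?thesis
    using anticommutative_algebra_axioms by (auto simp: Malcev_def Sagle_def Lie_def)
qed

text \<open>The only products of four factors left are \<open>(xy)(zw)\<close>, so
  \<open>J(x,y,zw) = (xy)(zw)\<close>. This changes sign when the pairs are exchanged, as CD
  requires, but \<open>(e 0 e 1)(e 0 e 2) = e 5\<close> violates the Malcev identity.\<close>

lemma ex_CD_not_Malcev:
  fixes T :: "(nat \<times> nat \<times> nat \<times> 'k::field) list"
  assumes "CHAR('k) \<noteq> 2"
  defines "T \<equiv> [(0, 2, 3, 1), (0, 1, 4, 1), (4, 3, 5, 1)]"
  shows "(coeff_scale, table_mul T) \<in> CD - Malcev"
proof -
  interpret anticommutative_algebra coeff_scale "table_mul T"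
    by (rule anticommutative_table_mul)
  have triple: "table_mul T (table_mul T (table_mul T x y) z) w = 0" for x y z w
    by (rule poly_mapping_eqI, simp add: T_def table_simps)
  then have JA: "table_mul T (J x y z) w = 0" for x y z w
    by (simp add: jacobiator_def mul_simps)
  have "J x y (table_mul T z w) = table_mul T (table_mul T x y) (table_mul T z w)" for x y z w
    using triple[of z w x y] triple[of z w y x]
    by (simp add: jacobiator_def mul_simps anticommute[of y "table_mul T z w"])
  then have "J x y (table_mul T z w) = - J z w (table_mul T x y)" for x y z w
    using anticommute by metis
  with JA have "(coeff_scale, table_mul T) \<in> CD"
    unfolding CD_iff[OF assms(1)] by blast
  moreover have "coord (J (e 0) (e 1) (table_mul T (e 0) (e 2))) 5 = 1"
    by (simp add: T_def table_simps)
  then have "J (e 0) (e 1) (table_mul T (e 0) (e 2)) \<noteq> 0" by auto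
  ultimately show ?thesis
    by (auto simp: Malcev_def JA)
qed

text \<open>All Jacobiators are multiples of \<open>e 4\<close>, which annihilates the algebra,
  while \<open>J(e 2, e 0, e 1) = e 4\<close> with \<open>e 2 = e 0 e 1\<close>.\<close>

lemma ex_AlmostLie_not_BinaryLie:
  fixes T :: "(nat \<times> nat \<times> nat \<times> 'k::field) list"
  defines "T \<equiv> [(0, 1, 2, 1), (2, 0, 3, 1), (3, 1, 4, 1)]"
  shows "(coeff_scale, table_mul T) \<in> AlmostLie - BinaryLie"
proof -
  interpret anticommutative_algebra coeff_scale "table_mul T"
    by (rule anticommutative_table_mul)
  have "table_mul T (J x y z) w = 0" for x y z w
    by (rule poly_mapping_eqI, simp add: T_def table_simps algebra_simps)
  moreover have "coord (J (table_mul T (e 0) (e 1)) (e 0) (e 1)) 4 = 1"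
    by (simp add: T_def table_simps)
  then have "J (table_mul T (e 0) (e 1)) (e 0) (e 1) \<noteq> 0" by auto
  ultimately show ?thesis
    using anticommutative_algebra_axioms by (auto simp: AlmostLie_def BinaryLie_def)
qed

text \<open>
  This is the non-Lie solvable Malcev algebra of dimension 4, with
  \<open>J(e\<^sub>0, e\<^sub>1, e\<^sub>2) = 3 e\<^sub>3\<close>; in characteristic 3 it is Lie.
\<close>

lemma ex_BinaryLie_not_AlmostLie:
  fixes T :: "(nat \<times> nat \<times> nat \<times> 'k::field) list"
  assumes "CHAR('k) \<noteq> 3"
  defines "T \<equiv> [(0, 1, 1, 1), (0, 2, 2, 1), (0, 3, 3, - 1), (1, 2, 3, 1)]"
  shows "(coeff_scale, table_mul T) \<in> BinaryLie - AlmostLie"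
proof -
  interpret anticommutative_algebra coeff_scale "table_mul T"
    by (rule anticommutative_table_mul)
  have "coord (J (table_mul T x y) x y) n = 0" for x y n
  proof -
    \<comment> \<open>Products only have coordinates 1, 2 and 3, the targets in the table.\<close>
    consider "n = 1" | "n = 2" | "n = 3" | "n \<notin> {1, 2, 3}" by blast
    then show ?thesis
      by cases (simp_all add: T_def table_simps algebra_simps)
  qed
  then have "J (table_mul T x y) x y = 0" for x y
    by (simp add: poly_mapping_eqI)
  \<comment> \<open>The factor \<open>e 0\<close> fixes \<open>e 3\<close> under right
    multiplication, so the Jacobiator \<open>3 e 3\<close> is not annihilated.\<close>
  moreover have "coord (table_mul T (J (e 0) (e 1) (e 2)) (e 0)) 3 = 3"
    by (simp add: T_def table_simps)
  then have "table_mul T (J (e 0) (e 1) (e 2)) (e 0) \<noteq> 0"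
    using three_neq_0_field[OF assms(1)] by auto
  ultimately show ?thesis
    using anticommutative_algebra_axioms by (auto simp: AlmostLie_def BinaryLie_def)
qed

section \<open>The inclusions and their strictness\<close>

lemma Lie_subset: "(Lie :: ('k::field, 'a::ab_group_add) algebra set) \<subseteq> Malcev \<inter> Sagle"
proof clarify
  fix scale :: "'k \<Rightarrow> 'a \<Rightarrow> 'a" and mul
  assume Lie: "(scale, mul) \<in> Lie"
  then interpret anticommutative_algebra scale mul
    by (simp add: Lie_def)
  show "(scale, mul) \<in> Malcev \<inter> Sagle"
    using Lie anticommutative_algebra_axioms by (simp add: Lie_def Malcev_def Sagle_def mul_simps)
qed

lemma Malcev_Sagle_subset_CD:
  assumes "CHAR('k::field) \<noteq> 2" "CHAR('k) \<noteq> 3"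
  shows "(Malcev \<inter> Sagle :: ('k, 'a::ab_group_add) algebra set) \<subseteq> CD"
proof clarify
  fix scale :: "'k \<Rightarrow> 'a \<Rightarrow> 'a" and mul
  assume *: "(scale, mul) \<in> Malcev" "(scale, mul) \<in> Sagle"
  then interpret anticommutative_algebra scale mul
    by (simp add: Malcev_def)
  show "(scale, mul) \<in> CD"
    using Malcev_Sagle_imp[OF assms *] by (simp add: CD_iff[OF assms(1)])
qed

lemma CD_subset:
  assumes "CHAR('k::field) \<noteq> 2"
  shows "(CD :: ('k, 'a::ab_group_add) algebra set) \<subseteq> BinaryLie \<inter> AlmostLie"
proof clarify
  fix scale :: "'k \<Rightarrow> 'a \<Rightarrow> 'a" and mul
  assume *: "(scale, mul) \<in> CD"
  then interpret anticommutative_algebra scale mul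
    by (simp add: CD_def)
  have JA: "mul (J x y z) w = 0" and swap: "J x y (mul z w) = - J z w (mul x y)" for x y z w
    using * unfolding CD_iff[OF assms] by blast+
  have "J (mul x y) x y = 0" for x y
  proof -
    have "J x y (mul x y) + J x y (mul x y) = 0"
      using swap[of x y x y] by (metis add.left_inverse)
    with double_eq_0D[OF assms] show ?thesis
      by (metis J_rotate)
  qed
  then show "(scale, mul) \<in> BinaryLie \<inter> AlmostLie"
    using JA anticommutative_algebra_axioms by (simp add: BinaryLie_def AlmostLie_def)
qed

theorem proposition1:
  assumes "CHAR('k::field) \<noteq> 2" and "CHAR('k) \<noteq> 3"
  shows
    "((Lie :: ('k, 'a::ab_group_add) algebra set) \<subseteq> Malcev \<inter> Sagle \<and>
      (Malcev \<inter> Sagle :: ('k, 'a) algebra set) \<subseteq> CD \<and>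
      (CD :: ('k, 'a) algebra set) \<subseteq> BinaryLie \<and>
      (CD :: ('k, 'a) algebra set) \<subseteq> AlmostLie) \<and>
     ((Lie :: ('k, nat \<Rightarrow>\<^sub>0 'k) algebra set) \<subset> Malcev \<inter> Sagle \<and>
      (Malcev \<inter> Sagle :: ('k, nat \<Rightarrow>\<^sub>0 'k) algebra set) \<subset> CD \<and>
      (CD :: ('k, nat \<Rightarrow>\<^sub>0 'k) algebra set) \<subset> BinaryLie \<and>
      (CD :: ('k, nat \<Rightarrow>\<^sub>0 'k) algebra set) \<subset> AlmostLie)"
proof (intro conjI psubsetI)
  note subs = Lie_subset Malcev_Sagle_subset_CD[OF assms]
    order_trans[OF CD_subset[OF assms(1)] Int_lower1]
    order_trans[OF CD_subset[OF assms(1)] Int_lower2]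
  show "(Lie :: ('k, 'a) algebra set) \<subseteq> Malcev \<inter> Sagle"
    "(Malcev \<inter> Sagle :: ('k, 'a) algebra set) \<subseteq> CD"
    "(CD :: ('k, 'a) algebra set) \<subseteq> BinaryLie"
    "(CD :: ('k, 'a) algebra set) \<subseteq> AlmostLie"
    by (rule subs)+
  show "(Lie :: ('k, nat \<Rightarrow>\<^sub>0 'k) algebra set) \<subseteq> Malcev \<inter> Sagle"
    "(Malcev \<inter> Sagle :: ('k, nat \<Rightarrow>\<^sub>0 'k) algebra set) \<subseteq> CD"
    "(CD :: ('k, nat \<Rightarrow>\<^sub>0 'k) algebra set) \<subseteq> BinaryLie"
    "(CD :: ('k, nat \<Rightarrow>\<^sub>0 'k) algebra set) \<subseteq> AlmostLie"
    by (rule subs)+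
  show "(Lie :: ('k, nat \<Rightarrow>\<^sub>0 'k) algebra set) \<noteq> Malcev \<inter> Sagle"
    using ex_Malcev_Sagle_not_Lie by blast
  show "(Malcev \<inter> Sagle :: ('k, nat \<Rightarrow>\<^sub>0 'k) algebra set) \<noteq> CD"
    using ex_CD_not_Malcev[OF assms(1)] by blast
  \<comment> \<open>CD algebras lie in both larger varieties, so an algebra in exactly one of these
    is not CD.\<close>
  show "(CD :: ('k, nat \<Rightarrow>\<^sub>0 'k) algebra set) \<noteq> BinaryLie"
    using ex_BinaryLie_not_AlmostLie[OF assms(2)] CD_subset[OF assms(1)] by blast
  show "(CD :: ('k, nat \<Rightarrow>\<^sub>0 'k) algebra set) \<noteq> AlmostLie"
    using ex_AlmostLie_not_BinaryLie CD_subset[OF assms(1)] by blast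
qed

end
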